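(* Consider the damped Hamiltonian system $\dot{x}=S\nabla H(x)-D(t)x$ on $\mathbb{R}^N$, where $H:\mathbb{R}^N\to\mathbb{R}$ is continuously differentiable, $D(t)\in\mathbb{R}^{N\times N}$ is a diagonal matrix depending continuously on $t$, and $S\in\mathbb{R}^{N\times N}$ is skew-symmetric and constant over the time step. Let $t_0\in\mathbb{R}$, $h>0$, $t_1=t_0+h$, let $\eta$ be a positive continuous function on $[t_0,t_1]$, and set $$Y(t)=\int_{t_0+h/2}^{t}D(\tau)\,\mathrm{d}\tau,\qquad \phi(t)=\int_{t_0+h/2}^{t}\eta(\tau)\,\mathrm{d}\tau .$$ Let $c_1,\dots,c_s$ be distinct real numbers whose associated weights $b_i$ are all nonzero, and let $x_1\in\mathbb{R}^N$ be a numerical solution obtained from $x_0\in\mathbb{R}^N$ after one step of size $h$ (from $t_0$ to $t_1$) of the exponential energy-preserving collocation method with nodes $c_1,\dots,c_s$. Suppose that $$H\big(e^{Y(t)}x\big)=e^{\phi(t)}H(x)\qquad\text{for all } t\in[t_0,t_1],\ x\in\mathbb{R}^N .$$ Then the method preserves the dissipation rate corresponding to $\frac{\mathrm{d}}{\mathrm{d}t}H(x)=-\eta(t)H(x)$, that is, $$H(x_1)=e^{\phi(t_0)-\phi(t_1)}H(x_0)=e^{-\int_{t_0}^{t_1}\eta(\tau)\,\mathrm{d}\tau}\,H(x_0).$$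
   Context: Exponential energy-preserving collocation method. Given distinct real numbers $c_1,\dots,c_s$ (usually $0\le c_i\le 1$), put $$\ell_i(\tau)=\prod_{j=1,\,j\ne i}^{s}\frac{\tau-c_j}{c_i-c_j},\qquad b_i=\int_0^1\ell_i(\tau)\,\mathrm{d}\tau,\qquad A_{\tau,\sigma}=\sum_{i=1}^{s}\frac{1}{b_i}\Big(\int_0^{\tau}\ell_i(\alpha)\,\mathrm{d}\alpha\Big)\ell_i(\sigma),$$ where all $b_i$ are assumed nonzero. Let $f(x)=S\nabla H(x)$ and write $Y_\tau=Y(t_0+\tau h)$ for $\tau\in[0,1]$, so $Y_0=Y(t_0)$ and $Y_1=Y(t_0+h)$; these are diagonal matrices and $e^{Y_\tau}$ is the matrix exponential. One step of the method is defined implicitly: $x_1$ is a numerical solution obtained from $x_0$ if there is a continuous family of stages $X_\tau\in\mathbb{R}^N$, $\tau\in[0,1]$, such that $$X_\tau=e^{-Y_\tau}\Big(e^{Y_0}x_0+h\int_0^1A_{\tau,\sigma}\,f\big(e^{Y_\sigma}X_\sigma\big)\,\mathrm{d}\sigma\Big)\quad(\tau\in[0,1]),\qquad x_1=e^{-Y_1}\Big(e^{Y_0}x_0+h\int_0^1 f\big(e^{Y_\sigma}X_\sigma\big)\,\mathrm{d}\sigma\Big).$$ Equivalently, there is a polynomial $v$ of degree at most $s$ with values in $\mathbb{R}^N$ such that $v(t_0)=e^{Y_0}x_0$, $\dot v(t_0+c_ih)=\frac{1}{b_i}\int_0^1\ell_i(\tau)\,S\nabla H(v(t_0+\tau h))\,\mathrm{d}\tau$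 for $i=1,\dots,s$, and $x_1=e^{-Y_1}v(t_0+h)$; the stages are $X_\tau=e^{-Y_\tau}v(t_0+\tau h)$. If in the differential equation the skew-symmetric matrix depends on $t$ or $x$, then $S$ in the method stands for a skew-symmetric matrix held fixed over the step, e.g. $S\big(\tfrac{t_0+t_1}{2},\tfrac{e^{Y_0}x_0+e^{Y_1}x_1}{2}\big)$. *)

theory Defs
  imports "HOL-Analysis.Analysis"
begin

text \<open>
  The type of square matrices is not an instance of \<^class>\<open>real_normed_algebra_1\<close> (its
  multiplication and powers are componentwise), so the library function \<^const>\<open>exp\<close> does not
  apply to it. Below, powers are with respect to the matrix product.
\<close>

definition matrix_pow :: "real^'n^'n \<Rightarrow> nat \<Rightarrow> real^'n^'n" where
  "matrix_pow A k = ((\<lambda>B. A ** B) ^^ k) (mat 1)"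

definition matrix_exp :: "real^'n^'n \<Rightarrow> real^'n^'n" where
  "matrix_exp A = (\<Sum>k. matrix_pow A k /\<^sub>R fact k)"

definition skew_symmetric :: "real^'n^'n \<Rightarrow> bool" where
  "skew_symmetric S \<longleftrightarrow> transpose S = - S"

definition diagonal_matrix :: "real^'n^'n \<Rightarrow> bool" where
  "diagonal_matrix A \<longleftrightarrow> (\<forall>i j. i \<noteq> j \<longrightarrow> A $ i $ j = 0)"

definition gradient :: "('a::real_inner \<Rightarrow> real) \<Rightarrow> 'a \<Rightarrow> 'a" where
  "gradient H x = (THE g. GDERIV H x :> g)"

definition continuously_differentiable :: "('a::real_inner \<Rightarrow> real) \<Rightarrow> bool" where
  "continuously_differentiable H \<longleftrightarrow>
     (\<forall>x. \<exists>g. GDERIV H x :> g) \<and> continuous_on UNIV (gradient H)"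

text \<open>
  Nodes \<open>c 1, \<dots>, c s\<close> are given by a function on the naturals, used only on \<open>{1..s}\<close>.
\<close>

definition lagrange_basis :: "nat \<Rightarrow> (nat \<Rightarrow> real) \<Rightarrow> nat \<Rightarrow> real \<Rightarrow> real" where
  "lagrange_basis s c i \<tau> = (\<Prod>j\<in>{1..s} - {i}. (\<tau> - c j) / (c i - c j))"

definition node_weight :: "nat \<Rightarrow> (nat \<Rightarrow> real) \<Rightarrow> nat \<Rightarrow> real" where
  "node_weight s c i = (LBINT \<tau>=0..1. lagrange_basis s c i \<tau>)"

definition stage_kernel :: "nat \<Rightarrow> (nat \<Rightarrow> real) \<Rightarrow> real \<Rightarrow> real \<Rightarrow> real" where
  "stage_kernel s c \<tau> \<sigma> =
     (\<Sum>i=1..s. 1 / node_weight s c i * (LBINT \<alpha>=0..\<tau>. lagrange_basis s c i \<alpha>)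
        * lagrange_basis s c i \<sigma>)"

text \<open>
  \<open>eep_collocation_step s c Y f t0 h x0 x1\<close>: one step of size \<open>h\<close> from \<open>t0\<close> can take \<open>x0\<close> to \<open>x1\<close>.
  This is a relation, because the implicit stage equation may have several solutions.
\<close>

definition eep_collocation_step ::
    "nat \<Rightarrow> (nat \<Rightarrow> real) \<Rightarrow> (real \<Rightarrow> real^'n^'n) \<Rightarrow> (real^'n \<Rightarrow> real^'n)
     \<Rightarrow> real \<Rightarrow> real \<Rightarrow> real^'n \<Rightarrow> real^'n \<Rightarrow> bool" where
  "eep_collocation_step s c Y f t0 h x0 x1 \<longleftrightarrow>
     (\<exists>X :: real \<Rightarrow> real^'n. continuous_on {0..1} X \<and>
        (\<forall>\<tau>\<in>{0..1}. X \<tau> =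
           matrix_exp (- Y (t0 + \<tau> * h)) *v
             (matrix_exp (Y t0) *v x0 +
              h *\<^sub>R (LBINT \<sigma>=0..1. stage_kernel s c \<tau> \<sigma> *\<^sub>R
                     f (matrix_exp (Y (t0 + \<sigma> * h)) *v X \<sigma>)))) \<and>
        x1 =
           matrix_exp (- Y (t0 + h)) *v
             (matrix_exp (Y t0) *v x0 +
              h *\<^sub>R (LBINT \<sigma>=0..1. f (matrix_exp (Y (t0 + \<sigma> * h)) *v X \<sigma>))))"

end

theory Submission
  imports Defs
begin

text \<open>
  In the coordinates \<open>v \<tau> = e^Y\<^sub>\<tau> X\<^sub>\<tau>\<close> the step is the energy-preserving collocation method:
  \<open>v\<close> starts at \<open>e^Y\<^sub>0 x\<^sub>0\<close>, ends at \<open>e^Y\<^sub>1 x\<^sub>1\<close> because the Lagrange basis sums to \<open>1\<close>, and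
  \<open>v' = h \<Sum>\<^sub>i (\<ell>\<^sub>i / b\<^sub>i) S g\<^sub>i\<close> with \<open>g\<^sub>i = \<integral> \<ell>\<^sub>i \<nabla>H(v)\<close>.  Hence
  \<open>H(v 1) - H(v 0) = \<integral> \<nabla>H(v) \<bullet> v' = h \<Sum>\<^sub>i (g\<^sub>i \<bullet> S g\<^sub>i) / b\<^sub>i = 0\<close>, and the hypothesis on \<open>H\<close> turns
  \<open>H(e^Y\<^sub>1 x\<^sub>1) = H(e^Y\<^sub>0 x\<^sub>0)\<close> into the claim.
\<close>

section \<open>Exponentials of diagonal matrices\<close>

lemma matrix_pow_diagonal:
  assumes "diagonal_matrix A"
  shows "matrix_pow A k $ i $ j = (if i = j then (A $ i $ i) ^ k else 0)"
proof (induction k arbitrary: i j)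
  case 0
  show ?case by (simp add: matrix_pow_def mat_def)
next
  case (Suc k)
  have "matrix_pow A (Suc k) $ i $ j = (\<Sum>l\<in>UNIV. A $ i $ l * matrix_pow A k $ l $ j)"
    by (simp add: matrix_pow_def matrix_matrix_mult_def)
  also have "\<dots> = (\<Sum>l\<in>UNIV. if l = i then A $ i $ i * matrix_pow A k $ i $ j else 0)"
    using assms by (intro sum.cong) (auto simp: diagonal_matrix_def)
  also have "\<dots> = A $ i $ i * matrix_pow A k $ i $ j"
    by simp
  finally show ?case by (simp add: Suc)
qed

text \<open>Limits of matrices are taken entrywise, and each diagonal entry runs through a real
  exponential series. In particular the series converges, so \<open>suminf\<close> is its genuine
  sum.\<close>

lemma matrix_exp_diagonal:
  fixes A :: "real^'n^'n"
  assumes "diagonal_matrix A"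
  shows "matrix_exp A = (\<chi> i j. if i = j then exp (A $ i $ i) else 0)"
proof -
  have "(\<lambda>k. matrix_pow A k /\<^sub>R fact k) sums (\<chi> i j. if i = j then exp (A $ i $ i) else 0)"
    unfolding sums_def
  proof (intro vec_tendstoI)
    fix i j
    have "(\<lambda>k. (matrix_pow A k /\<^sub>R fact k) $ i $ j) sums (if i = j then exp (A $ i $ i) else 0)"
      using exp_converges[of "A $ i $ i"]
      by (auto simp: matrix_pow_diagonal[OF assms])
    then show "(\<lambda>n. (\<Sum>k<n. matrix_pow A k /\<^sub>R fact k) $ i $ j)
        \<longlonglongrightarrow> (\<chi> i j. if i = j then exp (A $ i $ i) else 0) $ i $ j"
      by (simp add: sums_def)
  qed
  then show ?thesis
    unfolding matrix_exp_def by (simp add: sums_iff)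
qed

text \<open>Reduces inversion and continuity of the change of variables to the real exponential, one
  coordinate at a time.\<close>

lemma matrix_exp_diagonal_vector:
  assumes "diagonal_matrix A"
  shows "matrix_exp A *v x = (\<chi> i. exp (A $ i $ i) * x $ i)"
proof (simp only: vec_eq_iff, intro allI)
  fix i
  have "(matrix_exp A *v x) $ i = (\<Sum>j\<in>UNIV. if j = i then exp (A $ i $ i) * x $ i else 0)"
    unfolding matrix_exp_diagonal[OF assms] matrix_vector_mult_def vec_lambda_beta
    by (intro sum.cong) auto
  then show "(matrix_exp A *v x) $ i = (\<chi> i. exp (A $ i $ i) * x $ i) $ i"
    by simp
qed

lemma diagonal_matrix_uminus: "diagonal_matrix A \<Longrightarrow> diagonal_matrix (- A)"
  by (simp add: diagonal_matrix_def)

lemma matrix_exp_mult_matrix_exp_minus: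
  assumes "diagonal_matrix A"
  shows "matrix_exp A *v (matrix_exp (- A) *v x) = x"
  using assms
  by (simp add: matrix_exp_diagonal_vector diagonal_matrix_uminus vec_eq_iff exp_minus)

section \<open>Integrals of vector-valued functions\<close>

text \<open>For an integrable \<open>f\<close> the map \<open>T\<close> passes under the integral
  sign; otherwise the integral is 0 by convention and \<open>T\<close> sends 0 to 0. The
  \<open>min\<close> and \<open>max\<close> admit both orientations, which differ only by a
  sign.\<close>

lemma interval_integral_in_kernel:
  fixes f :: "real \<Rightarrow> 'a::euclidean_space" and a b :: real
    and T :: "'a \<Rightarrow> 'b::{banach, second_countable_topology}"
  assumes T: "bounded_linear T" and 0: "\<And>x. x \<in> {min a b..max a b} \<Longrightarrow> T (f x) = 0"
  shows "T (LBINT x=a..b. f x) = 0"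
proof -
  interpret T: bounded_linear T by (rule T)
  have *: "T (LINT x:E|lborel. f x) = 0" if E: "E \<subseteq> {min a b..max a b}" for E
  proof (cases "set_integrable lborel E f")
    case True
    then have "T (LINT x:E|lborel. f x) = (LINT x|lborel. T (indicator E x *\<^sub>R f x))"
      unfolding set_lebesgue_integral_def set_integrable_def
      using integral_bounded_linear[OF T] by metis
    moreover have "T (indicator E x *\<^sub>R f x) = 0" for x
      using E 0[of x] by (cases "x \<in> E") (auto simp: T.zero)
    ultimately show ?thesis by simp
  next
    case False
    then show ?thesis
      by (simp add: set_lebesgue_integral_def set_integrable_def not_integrable_integral_eq)
  qed
  show ?thesis
    unfolding interval_lebesgue_integral_def
    by (auto simp: T.neg intro!: *)
qed

text \<open>Each off-diagonal entry is a bounded linear functional vanishing on all values of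
  \<open>D\<close>. This makes Y(t) diagonal, also for t to the left of the midpoint.\<close>

lemma diagonal_matrix_interval_integral:
  fixes D :: "real \<Rightarrow> real^'n^'n" and a b :: real
  assumes "\<And>x. x \<in> {min a b..max a b} \<Longrightarrow> diagonal_matrix (D x)"
  shows "diagonal_matrix (LBINT x=a..b. D x)"
  unfolding diagonal_matrix_def
proof (intro allI impI)
  fix i j :: 'n
  assume "i \<noteq> j"
  have "bounded_linear (\<lambda>A :: real^'n^'n. A $ i $ j)"
    by (intro bounded_linear_compose[OF bounded_linear_vec_nth] bounded_linear_vec_nth)
  then show "(LBINT x=a..b. D x) $ i $ j = 0"
    using assms \<open>i \<noteq> j\<close>
    by (intro interval_integral_in_kernel[where T = "\<lambda>A. A $ i $ j"])
      (auto simp: diagonal_matrix_def)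
qed

lemma continuous_on_interval_integral:
  fixes f :: "real \<Rightarrow> 'a::euclidean_space"
  assumes "continuous_on {a..b} f" and "m \<in> {a..b}"
  shows "continuous_on {a..b} (\<lambda>t. LBINT x=m..t. f x)"
  using assms
  by (intro continuous_on_vector_derivative[OF interval_integral_FTC2]) auto

text \<open>Bridge from the Lebesgue integral of the definitions to the gauge integral in which the
  energy argument is carried out.\<close>

lemma interval_integral_eq_integral_continuous:
  fixes f :: "real \<Rightarrow> 'a::euclidean_space"
  assumes "a \<le> b" and "continuous_on {a..b} f"
  shows "(LBINT x=a..b. f x) = integral {a..b} f"
  using assms by (intro interval_integral_eq_integral borel_integrable_atLeastAtMost')

section \<open>The Lagrange basis\<close>

lemma continuous_on_lagrange_basis [continuous_intros]:
  "continuous_on A (lagrange_basis s c i)"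
proof -
  \<comment> \<open>The denominators are constants; writing them as factors
    \<open>inverse (c i - c j)\<close> leaves a product to which the continuity rules apply without
    nonzero side conditions.\<close>
  have "continuous_on A (\<lambda>\<tau>. \<Prod>j\<in>{1..s} - {i}. (\<tau> - c j) * inverse (c i - c j))"
    by (intro continuous_intros)
  then show ?thesis
    by (simp add: lagrange_basis_def[abs_def] divide_inverse)
qed

text \<open>Both sides are polynomials in \<tau> of degree at most s - 1 that agree at the s
  distinct nodes, hence they coincide.\<close>

lemma sum_lagrange_basis:
  assumes "s \<ge> 1" and inj: "inj_on c {1..s}"
  shows "(\<Sum>i=1..s. lagrange_basis s c i \<tau>) = 1"
proof -
  \<comment> \<open>The basis functions as formal polynomials, so that degrees can be
    counted.\<close>
  define q where "q i = (\<Prod>j\<in>{1..s} - {i}. smult (1 / (c i - c j)) [:- c j, 1:])" for i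
  have poly_q: "poly (q i) x = lagrange_basis s c i x" for i x
    by (simp add: q_def lagrange_basis_def poly_prod divide_inverse algebra_simps)
  have nodes: "lagrange_basis s c i (c k) = (if k = i then 1 else 0)"
    if "i \<in> {1..s}" "k \<in> {1..s}" for i k
  proof (cases "k = i")
    case True
    have "c i \<noteq> c j" if "j \<in> {1..s} - {i}" for j
      using inj \<open>i \<in> {1..s}\<close> that by (auto dest: inj_onD)
    then show ?thesis
      using True by (simp add: lagrange_basis_def)
  next
    case False
    \<comment> \<open>The factor with \<open>j = k\<close> vanishes.\<close>
    then show ?thesis
      using that by (auto simp: lagrange_basis_def intro!: prod_zero bexI[of _ k])
  qed
  have "degree (q i) \<le> s - 1" if "i \<in> {1..s}" for i
  proof -
    have "degree (q i) \<le> (\<Sum>j\<in>{1..s} - {i}. degree (smult (1 / (c i - c j)) [:- c j, 1:]))"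
      unfolding q_def by (rule order_trans[OF degree_prod_sum_le]) auto
    also have "\<dots> \<le> (\<Sum>j\<in>{1..s} - {i}. 1)"
      by (intro sum_mono) (auto intro: order_trans[OF degree_smult_le])
    finally show ?thesis using that by simp
  qed
  then have "degree (\<Sum>i=1..s. q i) \<le> s - 1"
    by (intro degree_sum_le) auto
  moreover have "card (c ` {1..s}) = s"
    using inj by (simp add: card_image)
  moreover have "poly (\<Sum>i=1..s. q i) x = poly 1 x" if "x \<in> c ` {1..s}" for x
    using that by (auto simp: poly_sum poly_q nodes)
  \<comment> \<open>Here s \<ge> 1 gives s - 1 < s in the naturals, so there are more nodes than the
    degree bound; for s = 0 the empty sum would be 0.\<close>
  ultimately have "(\<Sum>i=1..s. q i) = 1"
    using \<open>s \<ge> 1\<close> by (intro poly_eqI_degree[where A = "c ` {1..s}"]) auto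
  then have "poly (\<Sum>i=1..s. q i) \<tau> = 1"
    by simp
  then show ?thesis
    by (simp add: poly_sum poly_q)
qed

section \<open>Energy conservation of averaged skew-gradient flows\<close>

text \<open>Moving \<open>S\<close> to the other argument turns it into its transpose
  \<open>- S\<close>, so the number equals its own negative.\<close>

lemma skew_symmetric_inner_self:
  fixes S :: "real^'n^'n"
  assumes "skew_symmetric S"
  shows "x \<bullet> (S *v x) = 0"
proof -
  have "x \<bullet> (S *v x) = (transpose S *v x) \<bullet> x"
    by (simp flip: dot_lmul_matrix)
  also have "\<dots> = - (x \<bullet> (S *v x))"
    \<comment> \<open>The instance with first matrix 0 simplifies to
      \<open>(- S) *v x = - (S *v x)\<close>.\<close>
    using assms
    by (simp add: skew_symmetric_def inner_commute matrix_vector_mult_diff_rdistrib[of 0 S, simplified])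
  finally show ?thesis by simp
qed

text \<open>A vector is determined by its inner products with all vectors, so the description in
  \<open>gradient\<close> has exactly one solution.\<close>

lemma continuously_differentiable_GDERIV:
  assumes "continuously_differentiable H"
  shows "GDERIV H x :> gradient H x"
proof -
  obtain g where g: "GDERIV H x :> g"
    using assms by (auto simp: continuously_differentiable_def)
  moreover have "g' = g" if "GDERIV H x :> g'" for g'
  proof -
    have "(\<lambda>k. k \<bullet> g') = (\<lambda>k. k \<bullet> g)"
      using that g by (simp add: gderiv_def has_derivative_unique)
    then show ?thesis
      by (metis vector_eq_ldot)
  qed
  ultimately show ?thesis
    unfolding gradient_def by (rule theI)
qed

text \<open>The weights \<open>l i\<close> occur both in the velocity and in the averages of the
  gradient. By this symmetry the integrated rate of change of \<open>H\<close> is a combination of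
  the forms \<open>(S *v g i) \<bullet> g i\<close>, which all vanish, whatever the constants
  \<open>k i\<close>.\<close>

lemma averaged_skew_gradient_flow_conserves:
  fixes H :: "real^'n \<Rightarrow> real" and v :: "real \<Rightarrow> real^'n"
  assumes H: "continuously_differentiable H" and S: "skew_symmetric S"
    and "a \<le> b" and "finite I"
    and l: "\<And>i. i \<in> I \<Longrightarrow> continuous_on {a..b} (l i)"
    and v: "\<And>\<tau>. \<tau> \<in> {a..b} \<Longrightarrow> (v has_vector_derivative
      (\<Sum>i\<in>I. (k i * l i \<tau>) *\<^sub>R (S *v integral {a..b} (\<lambda>\<sigma>. l i \<sigma> *\<^sub>R gradient H (v \<sigma>)))))
      (at \<tau> within {a..b})"
  shows "H (v b) = H (v a)"
proof -
  define g where "g i = integral {a..b} (\<lambda>\<sigma>. l i \<sigma> *\<^sub>R gradient H (v \<sigma>))" for i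
  have "continuous_on {a..b} v"
    using continuous_on_vector_derivative[OF v] by blast
  then have "continuous_on {a..b} (\<lambda>\<sigma>. gradient H (v \<sigma>))"
    using H unfolding continuously_differentiable_def
    by (intro continuous_on_compose2[of UNIV "gradient H" _ v]) auto
  then have integrable: "(\<lambda>\<sigma>. l i \<sigma> *\<^sub>R gradient H (v \<sigma>)) integrable_on {a..b}" if "i \<in> I" for i
    using that l by (intro integrable_continuous_real continuous_intros)
  have "((\<lambda>\<tau>. H (v \<tau>)) has_vector_derivative
      (\<Sum>i\<in>I. (k i * l i \<tau>) *\<^sub>R (S *v g i)) \<bullet> gradient H (v \<tau>)) (at \<tau> within {a..b})"
    if "\<tau> \<in> {a..b}" for \<tau>
  proof -
    have "(H has_derivative (\<lambda>k. k \<bullet> gradient H (v \<tau>))) (at (v \<tau>))"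
      using continuously_differentiable_GDERIV[OF H] by (simp add: gderiv_def)
    from has_derivative_compose[OF v[OF that, unfolded has_vector_derivative_def] this]
    show ?thesis
      by (simp add: has_vector_derivative_def g_def)
  qed
  then have "((\<lambda>\<tau>. (\<Sum>i\<in>I. (k i * l i \<tau>) *\<^sub>R (S *v g i)) \<bullet> gradient H (v \<tau>))
      has_integral (H (v b) - H (v a))) {a..b}"
    by (intro fundamental_theorem_of_calculus \<open>a \<le> b\<close>)
  \<comment> \<open>The vectors \<open>S *v g i\<close> do not depend on \<tau>; shifting the weight
    \<open>l i \<tau>\<close> onto the gradient makes the remaining integral equal to
    \<open>g i\<close> again.\<close>
  moreover have "((\<lambda>\<tau>. (\<Sum>i\<in>I. (k i * l i \<tau>) *\<^sub>R (S *v g i)) \<bullet> gradient H (v \<tau>))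
      has_integral (\<Sum>i\<in>I. k i * ((S *v g i) \<bullet> g i))) {a..b}"
  proof -
    have "((\<lambda>\<tau>. \<Sum>i\<in>I. k i * ((S *v g i) \<bullet> (l i \<tau> *\<^sub>R gradient H (v \<tau>))))
        has_integral (\<Sum>i\<in>I. k i * ((S *v g i) \<bullet> g i))) {a..b}"
      unfolding g_def
      by (intro has_integral_sum \<open>finite I\<close> has_integral_mult_right
          has_integral_linear[OF _ bounded_linear_inner_right, unfolded o_def]
          integrable_integral integrable)
    then show ?thesis
      by (simp add: inner_sum_left mult.assoc)
  qed
  ultimately have "H (v b) - H (v a) = (\<Sum>i\<in>I. k i * ((S *v g i) \<bullet> g i))"
    by (rule has_integral_unique)
  also have "\<dots> = 0"
    by (simp add: inner_commute[of "S *v _"] skew_symmetric_inner_self[OF S])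
  finally show ?thesis by simp
qed

section \<open>The collocation step\<close>

text \<open>The kernel is a finite sum of products of a function of \<tau> and a function of
  \<sigma>, so the integral separates and \<tau> survives only in scalar coefficients.\<close>

lemma interval_integral_stage_kernel:
  fixes w :: "real \<Rightarrow> 'a::euclidean_space"
  assumes w: "continuous_on {0..1} w"
  shows "(LBINT \<sigma>=0..1. stage_kernel s c \<tau> \<sigma> *\<^sub>R w \<sigma>) =
    (\<Sum>i=1..s. (1 / node_weight s c i * (LBINT \<alpha>=0..\<tau>. lagrange_basis s c i \<alpha>)) *\<^sub>R
      integral {0..1} (\<lambda>\<sigma>. lagrange_basis s c i \<sigma> *\<^sub>R w \<sigma>))"
proof -
  have "continuous_on {0..1} (\<lambda>\<sigma>. stage_kernel s c \<tau> \<sigma> *\<^sub>R w \<sigma>)"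
    unfolding stage_kernel_def by (intro continuous_intros w)
  then have "(LBINT \<sigma>=0..1. stage_kernel s c \<tau> \<sigma> *\<^sub>R w \<sigma>) =
      integral {0..1} (\<lambda>\<sigma>. stage_kernel s c \<tau> \<sigma> *\<^sub>R w \<sigma>)"
    using interval_integral_eq_integral_continuous[of 0 1]
    by (simp add: zero_ereal_def one_ereal_def)
  also have "\<dots> = integral {0..1} (\<lambda>\<sigma>. \<Sum>i=1..s.
      (1 / node_weight s c i * (LBINT \<alpha>=0..\<tau>. lagrange_basis s c i \<alpha>)) *\<^sub>R
        (lagrange_basis s c i \<sigma> *\<^sub>R w \<sigma>))"
    by (simp add: stage_kernel_def scaleR_sum_left)
  also have "\<dots> = (\<Sum>i=1..s. integral {0..1} (\<lambda>\<sigma>.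
      (1 / node_weight s c i * (LBINT \<alpha>=0..\<tau>. lagrange_basis s c i \<alpha>)) *\<^sub>R
        (lagrange_basis s c i \<sigma> *\<^sub>R w \<sigma>)))"
    by (intro integral_sum integrable_continuous_real continuous_intros w) auto
  finally show ?thesis
    by (simp only: integral_cmul)
qed

lemma stage_kernel_0: "stage_kernel s c 0 \<sigma> = 0"
  by (simp add: stage_kernel_def zero_ereal_def)

text \<open>At \<tau> = 1 the inner integral is the weight itself and cancels its reciprocal,
  leaving the sum of the Lagrange basis. Thus the formula for the new value is the stage formula at
  \<tau> = 1.\<close>

lemma stage_kernel_1:
  assumes "s \<ge> 1" and "inj_on c {1..s}" and "\<forall>i\<in>{1..s}. node_weight s c i \<noteq> 0"
  shows "stage_kernel s c 1 \<sigma> = 1"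
proof -
  have "stage_kernel s c 1 \<sigma> = (\<Sum>i=1..s. lagrange_basis s c i \<sigma>)"
    unfolding stage_kernel_def
    using assms(3) by (intro sum.cong) (auto simp: node_weight_def one_ereal_def)
  then show ?thesis
    using sum_lagrange_basis[OF assms(1,2)] by simp
qed

lemma eep_collocation_step_conserves:
  fixes H :: "real^'n \<Rightarrow> real"
  assumes H: "continuously_differentiable H" and S: "skew_symmetric S" and "h \<ge> 0"
    and Y: "continuous_on {t0..t0 + h} Y" "\<And>t. t \<in> {t0..t0 + h} \<Longrightarrow> diagonal_matrix (Y t)"
    and nodes: "s \<ge> 1" "inj_on c {1..s}" "\<forall>i\<in>{1..s}. node_weight s c i \<noteq> 0"
    and step: "eep_collocation_step s c Y (\<lambda>x. S *v gradient H x) t0 h x0 x1"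
  shows "H (matrix_exp (Y (t0 + h)) *v x1) = H (matrix_exp (Y t0) *v x0)"
proof -
  obtain X where contX: "continuous_on {0..1} X"
    and X: "\<And>\<tau>. \<tau> \<in> {0..1} \<Longrightarrow> X \<tau> = matrix_exp (- Y (t0 + \<tau> * h)) *v
        (matrix_exp (Y t0) *v x0 + h *\<^sub>R (LBINT \<sigma>=0..1. stage_kernel s c \<tau> \<sigma> *\<^sub>R
          (S *v gradient H (matrix_exp (Y (t0 + \<sigma> * h)) *v X \<sigma>))))"
    and x1: "x1 = matrix_exp (- Y (t0 + h)) *v
        (matrix_exp (Y t0) *v x0 + h *\<^sub>R (LBINT \<sigma>=0..1.
          S *v gradient H (matrix_exp (Y (t0 + \<sigma> * h)) *v X \<sigma>)))"
    using step unfolding eep_collocation_step_def by blast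
  \<comment> \<open>\<open>V\<close> and \<open>v\<close> are the same curve on the unit interval,
    seen in two ways: \<open>V\<close> inherits continuity from the stages, while \<open>v\<close>
    is an explicit right-hand side that can be differentiated.\<close>
  define V where "V \<sigma> = matrix_exp (Y (t0 + \<sigma> * h)) *v X \<sigma>" for \<sigma>
  define w where "w \<sigma> = S *v gradient H (V \<sigma>)" for \<sigma>
  define v where "v \<tau> = matrix_exp (Y t0) *v x0 +
    h *\<^sub>R (LBINT \<sigma>=0..1. stage_kernel s c \<tau> \<sigma> *\<^sub>R w \<sigma>)" for \<tau>
  have range: "t0 + \<tau> * h \<in> {t0..t0 + h}" if "\<tau> \<in> {0..1}" for \<tau>
    using that \<open>h \<ge> 0\<close> by (auto simp: mult_left_le_one_le)
  have Vv: "V \<tau> = v \<tau>" if "\<tau> \<in> {0..1}" for \<tau>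
    using X[OF that] matrix_exp_mult_matrix_exp_minus[OF Y(2)[OF range[OF that]]]
    unfolding V_def v_def w_def by simp
  have contYh: "continuous_on {0..1} (\<lambda>\<sigma>. Y (t0 + \<sigma> * h))"
    by (rule continuous_on_compose2[OF Y(1)]) (auto intro!: continuous_intros range)
  \<comment> \<open>On diagonal matrices the exponential acts through its diagonal entries, so
    continuity of \<open>V\<close> follows from that of \<open>Y\<close> and
    \<open>X\<close>.\<close>
  have "continuous_on {0..1} (\<lambda>\<sigma>. \<chi> i. exp (Y (t0 + \<sigma> * h) $ i $ i) * X \<sigma> $ i)"
    by (intro continuous_intros contYh contX)
  then have "continuous_on {0..1} V"
    by (rule continuous_on_eq) (simp only: V_def matrix_exp_diagonal_vector[OF Y(2)[OF range]])
  then have contG: "continuous_on {0..1} (\<lambda>\<sigma>. gradient H (V \<sigma>))"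
    using H unfolding continuously_differentiable_def
    by (intro continuous_on_compose2[of UNIV "gradient H" _ V]) auto
  then have contw: "continuous_on {0..1} w"
    unfolding w_def
    by (rule continuous_on_compose2[OF matrix_vector_mult_linear_continuous_on]) auto
  \<comment> \<open>The constant matrix \<open>S\<close> leaves the integral, and \<open>V\<close>
    gives way to \<open>v\<close>, so that the averages are taken along the curve that is
    differentiated.\<close>
  have average: "integral {0..1} (\<lambda>\<sigma>. lagrange_basis s c i \<sigma> *\<^sub>R w \<sigma>) =
      S *v integral {0..1} (\<lambda>\<sigma>. lagrange_basis s c i \<sigma> *\<^sub>R gradient H (v \<sigma>))" for i
  proof -
    have "integral {0..1} (\<lambda>\<sigma>. S *v (lagrange_basis s c i \<sigma> *\<^sub>R gradient H (V \<sigma>))) =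
        S *v integral {0..1} (\<lambda>\<sigma>. lagrange_basis s c i \<sigma> *\<^sub>R gradient H (V \<sigma>))"
      by (intro integral_linear[unfolded o_def] integrable_continuous_real continuous_intros contG)
        (auto intro: linear_conv_bounded_linear[THEN iffD1])
    moreover have "integral {0..1} (\<lambda>\<sigma>. lagrange_basis s c i \<sigma> *\<^sub>R gradient H (V \<sigma>)) =
        integral {0..1} (\<lambda>\<sigma>. lagrange_basis s c i \<sigma> *\<^sub>R gradient H (v \<sigma>))"
      by (intro integral_cong) (simp add: Vv)
    ultimately show ?thesis
      by (simp add: w_def matrix_vector_mult_scaleR)
  qed
  define u where
    "u i = S *v integral {0..1} (\<lambda>\<sigma>. lagrange_basis s c i \<sigma> *\<^sub>R gradient H (v \<sigma>))" for i
  \<comment> \<open>With the vectors \<open>u i\<close> constant, only the integrals of the basis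
    functions depend on \<tau>, and the fundamental theorem of calculus differentiates them.\<close>
  have v_eq: "v = (\<lambda>\<tau>. matrix_exp (Y t0) *v x0 + (\<Sum>i=1..s.
      (h / node_weight s c i * (LBINT \<alpha>=0..\<tau>. lagrange_basis s c i \<alpha>)) *\<^sub>R u i))"
  proof
    fix \<tau>
    show "v \<tau> = matrix_exp (Y t0) *v x0 + (\<Sum>i=1..s.
        (h / node_weight s c i * (LBINT \<alpha>=0..\<tau>. lagrange_basis s c i \<alpha>)) *\<^sub>R u i)"
      by (simp add: v_def[of \<tau>] interval_integral_stage_kernel[OF contw] average u_def
          scaleR_sum_right)
  qed
  have "(v has_vector_derivative
      (\<Sum>i=1..s. (h / node_weight s c i * lagrange_basis s c i \<tau>) *\<^sub>R u i))
      (at \<tau> within {0..1})" if "\<tau> \<in> {0..1}" for \<tau>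
  proof -
    have *: "((\<lambda>\<tau>. LBINT \<alpha>=0..\<tau>. lagrange_basis s c i \<alpha>) has_real_derivative
        lagrange_basis s c i \<tau>) (at \<tau> within {0..1})" for i
      using interval_integral_FTC2[of 0 0 1 "lagrange_basis s c i" \<tau>] that
      by (simp add: continuous_on_lagrange_basis has_real_derivative_iff_has_vector_derivative
          zero_ereal_def)
    have "((\<lambda>\<tau>. (h / node_weight s c i * (LBINT \<alpha>=0..\<tau>. lagrange_basis s c i \<alpha>)) *\<^sub>R u i)
        has_vector_derivative (h / node_weight s c i * lagrange_basis s c i \<tau>) *\<^sub>R u i)
        (at \<tau> within {0..1})" for i
      using has_vector_derivative_scaleR[OF DERIV_cmult[OF *, of "h / node_weight s c i"]
          has_vector_derivative_const[of "u i"]]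
      by simp
    from has_vector_derivative_add[OF has_vector_derivative_const has_vector_derivative_sum[OF this]]
    show ?thesis
      unfolding v_eq by simp
  qed
  then have "H (v 1) = H (v 0)"
    unfolding u_def
    by (intro averaged_skew_gradient_flow_conserves[OF H S, where I = "{1..s}"
          and l = "lagrange_basis s c" and k = "\<lambda>i. h / node_weight s c i"])
      (auto intro: continuous_on_lagrange_basis)
  moreover have "v 0 = matrix_exp (Y t0) *v x0"
    by (simp add: v_def stage_kernel_0)
  moreover have "v 1 = matrix_exp (Y (t0 + h)) *v x1"
    using \<open>h \<ge> 0\<close>
    by (simp add: x1 v_def w_def V_def stage_kernel_1[OF nodes] matrix_exp_mult_matrix_exp_minus Y(2))
  ultimately show ?thesis by simp
qed

section \<open>Dissipation rate in the original variables\<close>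

theorem theorem1:
  fixes H :: "real^'n \<Rightarrow> real"
    and D :: "real \<Rightarrow> real^'n^'n"
    and S :: "real^'n^'n"
    and \<eta> :: "real \<Rightarrow> real"
    and Y :: "real \<Rightarrow> real^'n^'n"
    and \<phi> :: "real \<Rightarrow> real"
    and t0 h t1 :: real
    and s :: nat
    and c :: "nat \<Rightarrow> real"
    and x0 x1 :: "real^'n"
  assumes "continuously_differentiable H"
    and "h > 0"
    and "t1 = t0 + h"
    and "continuous_on {t0..t1} D"
    and "\<forall>t\<in>{t0..t1}. diagonal_matrix (D t)"
    and "skew_symmetric S"
    and "continuous_on {t0..t1} \<eta>"
    and "\<forall>t\<in>{t0..t1}. \<eta> t > 0"
    and "\<forall>t\<in>{t0..t1}. Y t = (LBINT \<tau>=t0 + h / 2..t. D \<tau>)"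
    and "\<forall>t\<in>{t0..t1}. \<phi> t = (LBINT \<tau>=t0 + h / 2..t. \<eta> \<tau>)"
    and "s \<ge> 1"
    and "inj_on c {1..s}"
    and "\<forall>i\<in>{1..s}. node_weight s c i \<noteq> 0"
    and "eep_collocation_step s c Y (\<lambda>x. S *v gradient H x) t0 h x0 x1"
    and "\<forall>t\<in>{t0..t1}. \<forall>x. H (matrix_exp (Y t) *v x) = exp (\<phi> t) * H x"
  shows "H x1 = exp (\<phi> t0 - \<phi> t1) * H x0
       \<and> exp (\<phi> t0 - \<phi> t1) * H x0 = exp (- (LBINT \<tau>=t0..t1. \<eta> \<tau>)) * H x0"
proof -
  note [simp] = \<open>t1 = t0 + h\<close>
  let ?m = "t0 + h / 2"
  have m: "?m \<in> {t0..t0 + h}"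
    using \<open>h > 0\<close> by auto
  have Y_eq: "Y t = (LBINT \<tau>=?m..t. D \<tau>)" if "t \<in> {t0..t0 + h}" for t
    using assms(9) that by simp
  have "continuous_on {t0..t0 + h} (\<lambda>t. LBINT \<tau>=?m..t. D \<tau>)"
    using continuous_on_interval_integral[OF _ m] assms(4) by simp
  then have "continuous_on {t0..t0 + h} Y"
    by (rule continuous_on_eq) (simp add: Y_eq)
  moreover have "diagonal_matrix (Y t)" if "t \<in> {t0..t0 + h}" for t
  proof -
    \<comment> \<open>The midpoint lies in the step interval, so integrating from it to t in either
      direction only meets diagonal values of \<open>D\<close>.\<close>
    have "{min ?m t..max ?m t} \<subseteq> {t0..t1}"
      using that m by auto
    then show ?thesis
      unfolding Y_eq[OF that] using assms(5) by (intro diagonal_matrix_interval_integral) blast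
  qed
  ultimately have "H (matrix_exp (Y (t0 + h)) *v x1) = H (matrix_exp (Y t0) *v x0)"
    using assms by (intro eep_collocation_step_conserves) auto
  \<comment> \<open>The scaling hypothesis, at t1 for \<open>x1\<close> and at t0 for
    \<open>x0\<close>, turns conservation in the transformed variables into a relation in the
    original ones.\<close>
  then have "exp (\<phi> t1) * H x1 = exp (\<phi> t0) * H x0"
    using assms(15) \<open>h > 0\<close> by simp
  then have "H x1 = exp (\<phi> t0 - \<phi> t1) * H x0"
    by (simp add: exp_diff field_simps)
  moreover have "\<phi> t0 - \<phi> t1 = - (LBINT \<tau>=t0..t1. \<eta> \<tau>)"
  proof -
    have "set_integrable lborel {t0..t1} \<eta>"
      using assms(7) by (rule borel_integrable_atLeastAtMost')
    then have "(LBINT \<tau>=t0..?m. \<eta> \<tau>) + (LBINT \<tau>=?m..t1. \<eta> \<tau>) = (LBINT \<tau>=t0..t1. \<eta> \<tau>)"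
      using \<open>h > 0\<close>
      by (intro interval_integral_sum)
        (auto simp: interval_lebesgue_integrable_def min_def max_def
          intro: set_integrable_subset)
    \<comment> \<open>At t0 the integral defining \<phi> runs backwards from the midpoint, hence the
      sign.\<close>
    moreover have "\<phi> t0 = - (LBINT \<tau>=t0..?m. \<eta> \<tau>)"
      using assms(10) \<open>h > 0\<close> interval_integral_endpoints_reverse[of ?m t0 \<eta>] by simp
    moreover have "\<phi> t1 = (LBINT \<tau>=?m..t1. \<eta> \<tau>)"
      using assms(10) \<open>h > 0\<close> by simp
    ultimately show ?thesis by simp
  qed
  ultimately show ?thesis by simp
qed

end
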